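(* Let $A\in\mathbb{R}^{m\times N}$, $f\in\mathbb{R}^m$, $\hat t>0$ and $u(\hat t)\in U_{\hat t}$. Set $r(\hat t)=f-Au(\hat t)$ and $p(\hat t)=\frac1{\hat t}A^T(f-Au(\hat t))$. Then the set of possible directions $\mathcal{D}(\hat t,u(\hat t))$ is the set of solutions of a nonnegative least squares problem; precisely, $\mathcal{D}(\hat t,u(\hat t))$ equals the set of minimizers of $$\Big\|Ad-\frac1{\hat t}r(\hat t)\Big\|_2^2$$ over all $d\in\mathbb{R}^N$ satisfying $d_i\,p(\hat t)_i\ge0$ for all $i\in\mathcal{E}(\hat t)\setminus\mathcal{A}(u(\hat t))$ and $d_i=0$ for all $i\notin\mathcal{E}(\hat t)$.
   Context: $[N]=\{1,\dots,N\}$; $A_i$ denotes the $i$-th column of $A$. For $t>0$, $U_t:=\operatorname{argmin}_{u\in\mathbb{R}^N}\frac12\|Au-f\|_2^2+t\|u\|_1$ (the set of minimizers), and $U_0:=\operatorname{argmin}\{\|u\|_1: u\in\mathbb{R}^N,\ A^T(Au-f)=0\}$. The active set of $u\in\mathbb{R}^N$ is $\mathcal{A}(u)=\{i\in[N]:u_i\ne0\}$. The equicorrelation set is $\mathcal{E}(t,u)=\{i\in[N]:|A_i^T(Au-f)|=t\}$, and $\mathcal{E}(\hat t):=\mathcal{E}(\hat t,u(\hat t))$ (it does not depend on the choice of $u(\hat t)\in U_{\hat t}$). The set of all possible directions at $(\hat t,u(\hat t))$ is $$\mathcal{D}(\hat t,u(\hat t))=\{d\in\mathbb{R}^N:\ \exists\,\delta\in(0,\hat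 t]\ \text{such that}\ u(\hat t)+(\hat t-t)d\in U_t\ \ \forall t\in[\hat t-\delta,\hat t]\}.$$ *)

theory Defs
  imports "HOL-Analysis.Analysis"
begin

definition l1_norm :: "real ^ 'n \<Rightarrow> real" where
  "l1_norm u = (\<Sum>i\<in>UNIV. \<bar>u $ i\<bar>)"

(* The set U_t. It is only meaningful for t \<ge> 0; for t = 0 it consists of the
   least-squares solutions of minimal l1 norm, not of all least-squares solutions. *)
definition lasso_solutions :: "real ^ 'n ^ 'm \<Rightarrow> real ^ 'm \<Rightarrow> real \<Rightarrow> (real ^ 'n) set" where
  "lasso_solutions A f t =
     (if t > 0
      then {u. is_arg_min (\<lambda>v. (norm (A *v v - f))\<^sup>2 / 2 + t * l1_norm v) (\<lambda>v. True) u}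
      else {u. is_arg_min l1_norm (\<lambda>v. transpose A *v (A *v v - f) = 0) u})"

definition active_set :: "real ^ 'n \<Rightarrow> 'n set" where
  "active_set u = {i. u $ i \<noteq> 0}"

definition equicorrelation_set ::
  "real ^ 'n ^ 'm \<Rightarrow> real ^ 'm \<Rightarrow> real \<Rightarrow> real ^ 'n \<Rightarrow> 'n set" where
  "equicorrelation_set A f t u = {i. \<bar>column i A \<bullet> (A *v u - f)\<bar> = t}"

(* t0 is the current parameter value; directions point towards decreasing t. *)
definition possible_directions ::
  "real ^ 'n ^ 'm \<Rightarrow> real ^ 'm \<Rightarrow> real \<Rightarrow> real ^ 'n \<Rightarrow> (real ^ 'n) set" where
  "possible_directions A f t0 u =
     {d. \<exists>\<delta>\<in>{0<..t0}. \<forall>t\<in>{t0 - \<delta>..t0}. u + (t0 - t) *\<^sub>R d \<in> lasso_solutions A f t}"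

end

theory Submission
  imports Defs
begin

text \<open>
  Both problems minimise a least squares term plus a separable convex function over a box of
  intervals, so their minimisers are characterised coordinate by coordinate. Put
  $w = A^T(r / t_0 - A d)$, half the negative gradient of the nonnegative least squares objective.
  At $t = t_0 - s$ the residual correlation of $u + s d$ is $t p + s w$, so the lasso condition
  on coordinate $i$ involves only $u_i, d_i, p_i, w_i$; that it holds for all small $s > 0$ is
  exactly the $i$-th optimality condition of the nonnegative least squares problem.
\<close>

section \<open>Optimality for least squares plus a separable convex term\<close>

lemma transpose_mult_nth: "(transpose A *v x) $ i = column i A \<bullet> x"
  for A :: "real ^ 'n ^ 'm"
  by (simp add: matrix_vector_mult_def transpose_def column_def inner_vec_def)

lemma power2_norm_add:
  "(norm (x + y))\<^sup>2 = (norm x)\<^sup>2 + 2 * (x \<bullet> y) + (norm y)\<^sup>2" for x y :: "'a::real_inner"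
  by (simp add: power2_norm_eq_inner inner_add_left inner_add_right inner_commute)

text \<open>Let \<open>e\<close> tend to 0 from the right. This discards the second-order term of a
  perturbation once its step length has been cancelled.\<close>

lemma nonneg_if_add_small_multiples_nonneg:
  fixes a b :: real
  assumes "\<And>e. 0 < e \<Longrightarrow> e \<le> 1 \<Longrightarrow> 0 \<le> a + e * b"
  shows "0 \<le> a"
proof (rule tendsto_lowerbound)
  show "((\<lambda>e. a + e * b) \<longlongrightarrow> a) (at_right 0)"
    by (auto intro!: tendsto_eq_intros)
  show "\<forall>\<^sub>F e in at_right 0. 0 \<le> a + e * b"
    using assms by (auto simp: eventually_at_right_field intro!: exI[of _ 1])
qed simp

text \<open>Here \<open>g\<close> is the negative gradient of the smooth part at \<open>v\<close>.
  Necessity comes from moving one coordinate a fraction \<open>e\<close> of the way towards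
  \<open>y\<close>: convexity bounds the change of \<open>h i\<close> linearly in \<open>e\<close>,
  while the quadratic error is of order \<open>e\<close> squared. Sufficiency comes from summing the
  coordinate inequalities. Keeping \<open>C\<close> and \<open>h\<close> general covers both
  problems: \<open>h i x = t * \<bar>x\<bar>\<close> on the whole line for the lasso, and
  \<open>h i = 0\<close> on a box for nonnegative least squares.\<close>

lemma is_arg_min_least_squares_separable_iff:
  fixes A :: "real ^ 'n ^ 'm" and b :: "real ^ 'm" and v :: "real ^ 'n"
    and h :: "'n \<Rightarrow> real \<Rightarrow> real"
  assumes h: "\<And>i. convex_on (C i) (h i)"
  defines "g \<equiv> transpose A *v (b - A *v v)"
  shows "is_arg_min (\<lambda>x. (norm (A *v x - b))\<^sup>2 / 2 + (\<Sum>i\<in>UNIV. h i (x $ i)))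
           (\<lambda>x. \<forall>i. x $ i \<in> C i) v \<longleftrightarrow>
         (\<forall>i. v $ i \<in> C i \<and> (\<forall>y \<in> C i. (y - v $ i) * g $ i \<le> h i y - h i (v $ i)))"
    (is "is_arg_min ?F ?P v \<longleftrightarrow> ?R")
proof
  assume min: "is_arg_min ?F ?P v"
  then have vC: "\<And>i. v $ i \<in> C i" and le: "\<And>x. (\<And>i. x $ i \<in> C i) \<Longrightarrow> ?F v \<le> ?F x"
    by (auto simp: is_arg_min_linorder)
  have "(y - v $ i) * g $ i \<le> h i y - h i (v $ i)" if y: "y \<in> C i" for i y
  proof -
    define c where "c = column i A"
    define z where "z = y - v $ i"
    have norm_sq: "(norm (q + k *\<^sub>R c))\<^sup>2 = (norm q)\<^sup>2 + 2 * k * (c \<bullet> q) + k\<^sup>2 * (norm c)\<^sup>2"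
      for q k
      by (simp add: power2_norm_add power_mult_distrib inner_commute)
    \<comment> \<open>This lower bounds an upper estimate of the increase of the objective, divided
      by \<open>e\<close>.\<close>
    have "0 \<le> (h i y - h i (v $ i) - z * g $ i) + e * (z\<^sup>2 * (norm c)\<^sup>2 / 2)"
      if e: "0 < e" "e \<le> 1" for e
    proof -
      define x where "x = v + (e * z) *\<^sub>R axis i 1"
      have xi: "x $ i = (1 - e) * v $ i + e * y"
        by (simp add: x_def z_def algebra_simps)
      have xj: "x $ j = v $ j" if "j \<noteq> i" for j
        using that by (simp add: x_def axis_def)
      have "x $ i \<in> C i"
        using convexD[OF convex_on_imp_convex[OF h] vC y, of "1 - e" e] e by (simp add: xi)
      then have F_le: "?F v \<le> ?F x"
        using le vC xj by metis
      have "A *v x - b = (A *v v - b) + (e * z) *\<^sub>R c"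
        by (simp add: x_def c_def matrix_vector_mult_basis algebra_simps
            matrix_vector_mult_scaleR)
      moreover have "c \<bullet> (A *v v - b) = - g $ i"
        by (simp only: g_def transpose_mult_nth c_def inner_diff_right minus_diff_eq)
      ultimately have "(norm (A *v x - b))\<^sup>2 =
          (norm (A *v v - b))\<^sup>2 - 2 * (e * (z * g $ i)) + 2 * (e * (e * (z\<^sup>2 * (norm c)\<^sup>2 / 2)))"
        by (simp only: norm_sq) (simp add: power2_eq_square)
      moreover have "(\<Sum>j\<in>UNIV. h j (x $ j)) - (\<Sum>j\<in>UNIV. h j (v $ j)) =
          h i (x $ i) - h i (v $ i)"
        using xj by (simp add: sum.remove[of UNIV i])
      moreover have "h i (x $ i) \<le> (1 - e) * h i (v $ i) + e * h i y"
        using convex_onD[OF h, of e "v $ i" i y] vC y e by (simp add: xi)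
      ultimately have
        "(z * g $ i) * e \<le> (h i y - h i (v $ i) + e * (z\<^sup>2 * (norm c)\<^sup>2 / 2)) * e"
        using F_le by (simp add: algebra_simps)
      then have "0 \<le> e * ((h i y - h i (v $ i) - z * g $ i) + e * (z\<^sup>2 * (norm c)\<^sup>2 / 2))"
        by (simp add: algebra_simps)
      then show ?thesis
        using e by (simp add: zero_le_mult_iff)
    qed
    then have "0 \<le> h i y - h i (v $ i) - z * g $ i"
      by (rule nonneg_if_add_small_multiples_nonneg)
    then show ?thesis
      by (simp add: z_def)
  qed
  with vC show ?R by blast
next
  assume R: ?R
  have "?F v \<le> ?F x" if x: "\<forall>i. x $ i \<in> C i" for x
  proof -
    \<comment> \<open>The square is expanded exactly around \<open>v\<close>: the cross term is
      governed by \<open>g\<close>, and the remaining squared norm can only increase the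
      objective.\<close>
    have "A *v x - b = (A *v v - b) + A *v (x - v)"
      by (simp add: matrix_vector_mult_diff_distrib)
    then have "(norm (A *v x - b))\<^sup>2 =
        (norm (A *v v - b))\<^sup>2 + 2 * ((A *v v - b) \<bullet> (A *v (x - v))) + (norm (A *v (x - v)))\<^sup>2"
      by (simp only: power2_norm_add)
    moreover have "(A *v v - b) \<bullet> (A *v (x - v)) = - ((x - v) \<bullet> g)"
      using dot_lmul_matrix[of "b - A *v v" A "x - v"]
      by (simp only: g_def transpose_matrix_vector inner_commute[of "x - v"])
        (simp add: inner_diff_left)
    moreover have "(x - v) \<bullet> g \<le> (\<Sum>i\<in>UNIV. h i (x $ i) - h i (v $ i))"
      unfolding inner_vec_def using R x by (intro sum_mono) simp
    moreover have "0 \<le> (norm (A *v (x - v)))\<^sup>2"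
      by simp
    ultimately show ?thesis
      unfolding sum_subtractf by argo
  qed
  with R show "is_arg_min ?F ?P v"
    by (simp add: is_arg_min_linorder)
qed

section \<open>Optimality conditions of the lasso\<close>

lemma abs_subgradient_iff:
  fixes g t v :: real
  assumes "t \<ge> 0"
  shows "(\<forall>y. (y - v) * g \<le> t * \<bar>y\<bar> - t * \<bar>v\<bar>) \<longleftrightarrow> \<bar>g\<bar> \<le> t \<and> (v \<noteq> 0 \<longrightarrow> g = t * sgn v)"
proof
  assume L: "\<forall>y. (y - v) * g \<le> t * \<bar>y\<bar> - t * \<bar>v\<bar>"
  \<comment> \<open>Unit steps to either side of \<open>v\<close> bound \<open>g\<close> from above
    and below, since the absolute value is 1-Lipschitz.\<close>
  have "t * (\<bar>v + c\<bar> - \<bar>v\<bar>) \<le> t * 1" if "\<bar>c\<bar> = 1" for c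
    using assms that by (intro mult_left_mono) auto
  from this[of 1] this[of "-1"] have "\<bar>g\<bar> \<le> t"
    using L[rule_format, of "v + 1"] L[rule_format, of "v - 1"] by (simp add: algebra_simps)
  moreover from this have "g = t * sgn v" if "v \<noteq> 0"
  proof -
    \<comment> \<open>The test point 0 gives \<open>t * \<bar>v\<bar> \<le> v * g\<close>. Splitting
      \<open>v\<close> into modulus and sign allows the modulus to be cancelled.\<close>
    have "\<bar>v\<bar> * t \<le> \<bar>v\<bar> * (sgn v * g)"
      using L[rule_format, of 0] by (cases v "0::real" rule: linorder_cases) (simp_all add: mult.commute)
    then have "t \<le> sgn v * g"
      using that by simp
    with \<open>\<bar>g\<bar> \<le> t\<close> that show ?thesis
      by (auto simp: sgn_if split: if_splits)
  qed
  ultimately show "\<bar>g\<bar> \<le> t \<and> (v \<noteq> 0 \<longrightarrow> g = t * sgn v)"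
    by blast
next
  assume R: "\<bar>g\<bar> \<le> t \<and> (v \<noteq> 0 \<longrightarrow> g = t * sgn v)"
  have "y * g \<le> t * \<bar>y\<bar>" for y
  proof -
    have "y * g \<le> \<bar>y\<bar> * \<bar>g\<bar>"
      by (metis abs_ge_self abs_mult)
    also have "\<dots> \<le> \<bar>y\<bar> * t"
      using R by (intro mult_left_mono) auto
    finally show ?thesis by (simp add: mult.commute)
  qed
  moreover have "v * g = t * \<bar>v\<bar>"
    using R by (cases v "0::real" rule: linorder_cases) simp_all
  ultimately show "\<forall>y. (y - v) * g \<le> t * \<bar>y\<bar> - t * \<bar>v\<bar>"
    by (simp add: left_diff_distrib)
qed

lemma lasso_solutions_iff:
  fixes A :: "real ^ 'n ^ 'm"
  assumes "t > 0"
  shows "v \<in> lasso_solutions A f t \<longleftrightarrow>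
    (\<forall>i. \<bar>(transpose A *v (f - A *v v)) $ i\<bar> \<le> t \<and>
         (v $ i \<noteq> 0 \<longrightarrow> (transpose A *v (f - A *v v)) $ i = t * sgn (v $ i)))"
proof -
  have "convex_on UNIV (\<lambda>x::real. t * \<bar>x\<bar>)"
    using assms convex_on_cmul[OF _ convex_on_dist[of UNIV "0::real"], of t]
    by (simp add: dist_real_def)
  from is_arg_min_least_squares_separable_iff[of "\<lambda>_. UNIV" "\<lambda>_ x. t * \<bar>x\<bar>" A f v, OF this]
  show ?thesis
    using assms by (simp add: lasso_solutions_def l1_norm_def sum_distrib_left abs_subgradient_iff)
qed

section \<open>Coordinatewise form of the nonnegative least squares problem\<close>

definition direction_range :: "'n set \<Rightarrow> 'n set \<Rightarrow> real ^ 'n \<Rightarrow> 'n \<Rightarrow> real set" where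
  "direction_range E S p i =
     (if i \<notin> E then {0} else if i \<in> S then UNIV else {x. 0 \<le> x * p $ i})"

lemma convex_direction_range: "convex (direction_range E S p i)"
proof -
  have "convex {x. 0 \<le> x * p $ i}"
    using convex_halfspace_ge[of 0 "p $ i"] by (simp only: inner_real_def mult.commute)
  then show ?thesis
    by (simp add: direction_range_def)
qed

text \<open>The feasible set is the product of the intervals \<open>direction_range E S p i\<close>,
  so the separable criterion applies with zero penalty; the factor 1/2 does not change the
  minimisers.\<close>

lemma nnls_iff:
  fixes A :: "real ^ 'n ^ 'm" and b :: "real ^ 'm" and d p :: "real ^ 'n"
  assumes "S \<subseteq> E"
  shows "is_arg_min (\<lambda>d. (norm (A *v d - b))\<^sup>2)
          (\<lambda>d. (\<forall>i \<in> E - S. d $ i * p $ i \<ge> 0) \<and> (\<forall>i. i \<notin> E \<longrightarrow> d $ i = 0)) d \<longleftrightarrow>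
    (\<forall>i. d $ i \<in> direction_range E S p i \<and>
       (\<forall>y \<in> direction_range E S p i. (y - d $ i) * (transpose A *v (b - A *v d)) $ i \<le> 0))"
proof -
  have feasible: "(\<forall>i \<in> E - S. x $ i * p $ i \<ge> 0) \<and> (\<forall>i. i \<notin> E \<longrightarrow> x $ i = 0) \<longleftrightarrow>
      (\<forall>i. x $ i \<in> direction_range E S p i)" for x :: "real ^ 'n"
    using assms by (auto simp: direction_range_def)
  have "convex_on (direction_range E S p i) (\<lambda>_. 0)" for i
    by (simp add: convex_on_const convex_direction_range)
  from is_arg_min_least_squares_separable_iff[of _ "\<lambda>_ _. 0" A b d, OF this]
  show ?thesis
    by (simp add: is_arg_min_linorder feasible)
qed

text \<open>The left side says that \<open>w\<close> lies in the normal cone of the interval at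
  \<open>a\<close>: every \<open>w\<close> is normal to a point, only 0 is normal to the whole line,
  and a half-line gives a sign condition with complementary slackness. Since
  \<open>\<bar>p $ i\<bar> = 1\<close> on \<open>E\<close>, the third kind is a genuine
  half-line.\<close>

lemma direction_range_normal_iff:
  fixes a w :: real
  assumes "i \<in> E \<longleftrightarrow> \<bar>p $ i\<bar> = 1"
  shows "a \<in> direction_range E S p i \<and> (\<forall>y \<in> direction_range E S p i. (y - a) * w \<le> 0) \<longleftrightarrow>
    (if i \<notin> E then a = 0 else if i \<in> S then w = 0
     else 0 \<le> a * p $ i \<and> w * p $ i \<le> 0 \<and> w * a = 0)"
proof -
  have *: "(\<forall>y. (y - a) * w \<le> 0) \<longleftrightarrow> w = 0"
  proof
    assume "\<forall>y. (y - a) * w \<le> 0"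
    from this[rule_format, of "a + w"] show "w = 0"
      by (simp add: mult_le_0_iff) linarith
  qed simp
  have **: "0 \<le> a * q \<and> (\<forall>y. 0 \<le> y * q \<longrightarrow> (y - a) * w \<le> 0) \<longleftrightarrow>
      0 \<le> a * q \<and> w * q \<le> 0 \<and> w * a = 0" if "\<bar>q\<bar> = 1" for q
  proof (intro conj_cong refl iffI allI impI)
    assume a: "0 \<le> a * q" and L: "\<forall>y. 0 \<le> y * q \<longrightarrow> (y - a) * w \<le> 0"
    have "q * q = 1"
      using that by (metis abs_mult_self_eq mult_1)
    \<comment> \<open>The point \<open>a + q\<close> is feasible because \<open>q * q = 1\<close>.
      Below, the feasible points 0 and \<open>2 * a\<close> bound \<open>w * a\<close> from both
      sides.\<close>
    then have "w * q \<le> 0"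
      using L[rule_format, of "a + q"] a by (simp add: algebra_simps)
    moreover have "w * a = 0"
      using L[rule_format, of "0"] L[rule_format, of "2 * a"] a by (simp add: algebra_simps)
    ultimately show "w * q \<le> 0 \<and> w * a = 0" ..
  next
    fix y
    assume "w * q \<le> 0 \<and> w * a = 0" and y: "0 \<le> y * q"
    moreover have "q = 1 \<or> q = - 1"
      using that by linarith
    ultimately show "(y - a) * w \<le> 0"
      by (auto simp: algebra_simps mult_le_0_iff)
  qed
  show ?thesis
    using assms * ** by (auto simp: direction_range_def)
qed

section \<open>One lasso coordinate along a short step\<close>

lemma eventually_iff_const:
  "F \<noteq> bot \<Longrightarrow> \<forall>\<^sub>F x in F. P x \<longleftrightarrow> Q \<Longrightarrow> eventually P F \<longleftrightarrow> Q"
  using eventually_subst[of P "\<lambda>_. Q" F] by simp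

text \<open>For small \<open>s\<close> each case freezes the relevant signs. If
  \<open>\<bar>p\<bar> < 1\<close>, the correlation stays strictly inside its bound, so the
  coordinate must stay 0. If \<open>a \<noteq> 0\<close>, its sign persists and equality leaves only
  \<open>w = 0\<close>. If \<open>a = 0\<close> and \<open>\<bar>p\<bar> = 1\<close>, the bound says
  \<open>w * p \<le> 0\<close>, and a nonzero \<open>b\<close> must have sign \<open>p\<close> and
  forces \<open>w = 0\<close>.\<close>

lemma eventually_lasso_coordinate_iff:
  fixes a b p w t0 :: real
  assumes t0: "t0 > 0" and p: "\<bar>p\<bar> \<le> 1" and a: "a \<noteq> 0 \<Longrightarrow> p = sgn a"
  shows "(\<forall>\<^sub>F s in at_right 0. \<bar>(t0 - s) * p + s * w\<bar> \<le> t0 - s \<and>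
       (a + s * b \<noteq> 0 \<longrightarrow> (t0 - s) * p + s * w = (t0 - s) * sgn (a + s * b))) \<longleftrightarrow>
    (if \<bar>p\<bar> \<noteq> 1 then b = 0 else if a \<noteq> 0 then w = 0 else 0 \<le> b * p \<and> w * p \<le> 0 \<and> w * b = 0)"
    (is "eventually ?L _ \<longleftrightarrow> _")
proof -
  have pos: "\<forall>\<^sub>F s in at_right 0. 0 < s \<and> s < t0"
    using t0 by (auto simp: eventually_at_right_field)
  have lin: "((\<lambda>s. x + s * y) \<longlongrightarrow> x) (at_right 0)" for x y :: real
    by (auto intro!: tendsto_eq_intros)
  consider "\<bar>p\<bar> < 1" | "\<bar>p\<bar> = 1" "a \<noteq> 0" | "\<bar>p\<bar> = 1" "a = 0"
    using p by linarith
  then show ?thesis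
  proof cases
    case 1
    then have a0: "a = 0"
      using a by (cases "a = 0") (auto simp: abs_sgn_eq)
    have "((\<lambda>s. t0 - s - \<bar>(t0 - s) * p + s * w\<bar>) \<longlongrightarrow> t0 - \<bar>t0 * p\<bar>) (at_right 0)"
      by (auto intro!: tendsto_eq_intros)
    moreover have "0 < t0 - \<bar>t0 * p\<bar>"
      using 1 t0 by (simp add: abs_mult)
    ultimately have "\<forall>\<^sub>F s in at_right 0. 0 < t0 - s - \<bar>(t0 - s) * p + s * w\<bar>"
      by (rule order_tendstoD)
    with pos have "\<forall>\<^sub>F s in at_right 0. ?L s \<longleftrightarrow> b = 0"
    proof eventually_elim
      case (elim s)
      \<comment> \<open>A nonzero coordinate would need a correlation of modulus exactly
        \<open>t0 - s\<close>, against the strict inequality.\<close>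
      have "\<bar>(t0 - s) * sgn (s * b)\<bar> = t0 - s" if "b \<noteq> 0"
        using elim that by (simp add: abs_mult abs_sgn_eq)
      with elim a0 show ?case
        by (cases "b = 0") auto
    qed
    from eventually_iff_const[OF trivial_limit_at_right_real this] 1 show ?thesis by simp
  next
    case 2
    \<comment> \<open>The expression is \<open>sgn a * (a + s * b)\<close>, so its positivity
      preserves the sign of the coordinate.\<close>
    have "\<forall>\<^sub>F s in at_right 0. 0 < \<bar>a\<bar> + s * (sgn a * b)"
      using 2 by (intro order_tendstoD(1)[OF lin]) simp
    with pos have "\<forall>\<^sub>F s in at_right 0. ?L s \<longleftrightarrow> w = 0"
    proof eventually_elim
      case (elim s)
      then have "sgn (a + s * b) = p"
        using a[OF 2(2)] 2(2) by (cases "a > 0") (auto simp: sgn_if)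
      moreover from this have "a + s * b \<noteq> 0"
        using 2 by auto
      ultimately show ?case
        using elim 2 by (auto simp: abs_mult)
    qed
    from eventually_iff_const[OF trivial_limit_at_right_real this] 2 show ?thesis by simp
  next
    case 3
    \<comment> \<open>This is \<open>\<bar>s * w\<bar> < t0 - s\<close> rearranged. A perturbation
      this small cannot carry the correlation from \<open>(t0 - s) * p\<close> to the opposite
      bound.\<close>
    have "\<forall>\<^sub>F s in at_right 0. 0 < t0 + s * (- 1 - \<bar>w\<bar>)"
      using t0 by (intro order_tendstoD(1)[OF lin]) simp
    with pos have "\<forall>\<^sub>F s in at_right 0. ?L s \<longleftrightarrow> 0 \<le> b * p \<and> w * p \<le> 0 \<and> w * b = 0"
    proof eventually_elim
      case (elim s)
      then have small: "\<bar>s * w\<bar> < t0 - s"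
        by (simp add: abs_mult algebra_simps)
      have s: "0 < s" using elim by simp
      have sgn_b: "sgn (s * b) = sgn b"
        using s by (simp add: sgn_mult)
      have sw: "0 < s * w \<longleftrightarrow> 0 < w" "s * w < 0 \<longleftrightarrow> w < 0" "s * w = 0 \<longleftrightarrow> w = 0"
        using s by (auto simp: zero_less_mult_iff mult_less_0_iff)
      from 3 have "p = 1 \<or> p = - 1" by linarith
      then show ?case
        using small sw s 3(2) unfolding sgn_b
        by (cases b "0::real" rule: linorder_cases; elim disjE) (auto simp: sgn_b mult_le_0_iff zero_le_mult_iff)
    qed
    from eventually_iff_const[OF trivial_limit_at_right_real this] 3 show ?thesis by simp
  qed
qed

section \<open>Possible directions as nonnegative least squares solutions\<close>

theorem theorem3p2:
  fixes A :: "real ^ 'n ^ 'm" and f r :: "real ^ 'm" and u p :: "real ^ 'n" and t0 :: real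
  assumes "t0 > 0"
    and "u \<in> lasso_solutions A f t0"
    and "r = f - A *v u"
    and "p = (1 / t0) *\<^sub>R (transpose A *v (f - A *v u))"
  shows "possible_directions A f t0 u =
    {d. is_arg_min (\<lambda>d. (norm (A *v d - (1 / t0) *\<^sub>R r))\<^sup>2)
          (\<lambda>d. (\<forall>i \<in> equicorrelation_set A f t0 u - active_set u. d $ i * p $ i \<ge> 0) \<and>
               (\<forall>i. i \<notin> equicorrelation_set A f t0 u \<longrightarrow> d $ i = 0)) d}"
proof -
  define E where "E = equicorrelation_set A f t0 u"
  define S where "S = active_set u"
  have t0: "t0 > 0" by fact
  have corr: "transpose A *v (f - A *v u) = t0 *\<^sub>R p"
    using assms by simp
  have opt: "\<bar>p $ i\<bar> \<le> 1" "u $ i \<noteq> 0 \<Longrightarrow> p $ i = sgn (u $ i)" for i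
    using assms(2) t0 unfolding lasso_solutions_iff[OF t0] corr
    by (auto simp: abs_mult)
  have E_iff: "i \<in> E \<longleftrightarrow> \<bar>p $ i\<bar> = 1" for i
  proof -
    have "column i A \<bullet> (A *v u - f) = - (t0 * p $ i)"
      using arg_cong[OF corr, of "\<lambda>x. x $ i"]
      by (simp add: transpose_mult_nth inner_diff_right del: transpose_matrix_vector)
    then show ?thesis
      using t0 by (simp add: E_def equicorrelation_set_def abs_mult)
  qed
  have S_iff: "i \<in> S \<longleftrightarrow> u $ i \<noteq> 0" for i
    by (simp add: S_def active_set_def)
  \<comment> \<open>On an active coordinate \<open>p\<close> equals a sign, hence has modulus
    1.\<close>
  have "S \<subseteq> E"
    using opt by (auto simp: S_iff E_iff sgn_if)
  have "d \<in> possible_directions A f t0 u \<longleftrightarrow>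
     is_arg_min (\<lambda>d. (norm (A *v d - (1 / t0) *\<^sub>R r))\<^sup>2)
       (\<lambda>d. (\<forall>i \<in> E - S. d $ i * p $ i \<ge> 0) \<and> (\<forall>i. i \<notin> E \<longrightarrow> d $ i = 0)) d" for d
  proof -
    define w where "w = transpose A *v ((1 / t0) *\<^sub>R r - A *v d)"
    \<comment> \<open>Because \<open>p\<close> is the transpose of \<open>A\<close> applied to
      \<open>r\<close>, divided by \<open>t0\<close>. This makes the correlation along
      \<open>d\<close> affine in \<open>s\<close> with only \<open>p\<close> and \<open>w\<close> in
      it.\<close>
    have w: "transpose A *v (A *v d) = p - w"
      using assms by (simp add: w_def matrix_vector_mult_diff_distrib matrix_vector_mult_scaleR)
    have corr_s: "(transpose A *v (f - A *v (u + s *\<^sub>R d))) $ i = (t0 - s) * p $ i + s * w $ i"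
      for s i
    proof -
      have "f - A *v (u + s *\<^sub>R d) = (f - A *v u) - s *\<^sub>R (A *v d)"
        by (simp add: matrix_vector_right_distrib matrix_vector_mult_scaleR)
      then have "transpose A *v (f - A *v (u + s *\<^sub>R d)) = t0 *\<^sub>R p - s *\<^sub>R (p - w)"
        by (simp only: matrix_vector_mult_diff_distrib matrix_vector_mult_scaleR w
            corr[unfolded matrix_vector_mult_diff_distrib])
      then show ?thesis
        by (simp only:) (simp add: algebra_simps)
    qed
    have "d \<in> possible_directions A f t0 u \<longleftrightarrow>
        (\<forall>\<^sub>F s in at_right 0. u + s *\<^sub>R d \<in> lasso_solutions A f (t0 - s))" (is "_ \<longleftrightarrow> ?ev")
    proof
      assume "d \<in> possible_directions A f t0 u"
      then obtain \<delta> where "0 < \<delta>"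
        and \<delta>: "\<And>t. t \<in> {t0 - \<delta>..t0} \<Longrightarrow> u + (t0 - t) *\<^sub>R d \<in> lasso_solutions A f t"
        by (auto simp: possible_directions_def)
      have "u + s *\<^sub>R d \<in> lasso_solutions A f (t0 - s)" if "0 < s" "s < \<delta>" for s
        using \<delta>[of "t0 - s"] that by simp
      then show ?ev
        using \<open>0 < \<delta>\<close> by (auto simp: eventually_at_right_field)
    next
      assume ?ev
      then obtain c where "0 < c"
        and c: "\<And>s. 0 < s \<Longrightarrow> s < c \<Longrightarrow> u + s *\<^sub>R d \<in> lasso_solutions A f (t0 - s)"
        by (auto simp: eventually_at_right_field)
      \<comment> \<open>Halving \<open>c\<close> keeps the closed interval of steps strictly below
        \<open>c\<close>, and the minimum with \<open>t0\<close> keeps \<open>t\<close> nonnegative.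
        The endpoint \<open>t = t0\<close> is the assumption on \<open>u\<close>.\<close>
      define \<delta> where "\<delta> = min t0 (c / 2)"
      have "u + (t0 - t) *\<^sub>R d \<in> lasso_solutions A f t" if "t \<in> {t0 - \<delta>..t0}" for t
        using c[of "t0 - t"] that assms(2) \<open>0 < c\<close> by (cases "t = t0") (auto simp: \<delta>_def)
      moreover have "\<delta> \<in> {0<..t0}"
        using t0 \<open>0 < c\<close> by (simp add: \<delta>_def)
      ultimately show "d \<in> possible_directions A f t0 u"
        unfolding possible_directions_def by blast
    qed
    also have "\<dots> \<longleftrightarrow> (\<forall>\<^sub>F s in at_right 0. \<forall>i. \<bar>(t0 - s) * p $ i + s * w $ i\<bar> \<le> t0 - s \<and>
        (u $ i + s * d $ i \<noteq> 0 \<longrightarrow>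
          (t0 - s) * p $ i + s * w $ i = (t0 - s) * sgn (u $ i + s * d $ i)))"
    \<comment> \<open>Steps below \<open>t0\<close> keep the parameter positive, where the lasso
      conditions apply.\<close>
    proof (rule eventually_cong)
      show "\<forall>\<^sub>F s in at_right 0. s < t0"
        using t0 by (auto simp: eventually_at_right_field)
    qed (simp add: lasso_solutions_iff corr_s del: transpose_matrix_vector)
    also have "\<dots> \<longleftrightarrow> (\<forall>i. if \<bar>p $ i\<bar> \<noteq> 1 then d $ i = 0 else if u $ i \<noteq> 0 then w $ i = 0
        else 0 \<le> d $ i * p $ i \<and> w $ i * p $ i \<le> 0 \<and> w $ i * d $ i = 0)"
      \<comment> \<open>Finitely many coordinates share a common threshold for \<open>s\<close>, so
        each can be treated alone.\<close>
      unfolding eventually_ball_finite_distrib[OF finite, where A = "UNIV :: 'n set", unfolded ball_UNIV]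
      by (rule iff_allI, rule eventually_lasso_coordinate_iff[OF t0 opt])
    also have "\<dots> \<longleftrightarrow> (\<forall>i. d $ i \<in> direction_range E S p i \<and>
       (\<forall>y \<in> direction_range E S p i. (y - d $ i) * w $ i \<le> 0))"
      by (simp only: direction_range_normal_iff[OF E_iff] S_iff E_iff not_not)
    also have "\<dots> \<longleftrightarrow> is_arg_min (\<lambda>d. (norm (A *v d - (1 / t0) *\<^sub>R r))\<^sup>2)
       (\<lambda>d. (\<forall>i \<in> E - S. d $ i * p $ i \<ge> 0) \<and> (\<forall>i. i \<notin> E \<longrightarrow> d $ i = 0)) d"
      unfolding nnls_iff[OF \<open>S \<subseteq> E\<close>] w_def ..
    finally show ?thesis .
  qed
  then show ?thesis
    unfolding E_def S_def by blast
qed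

end
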